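(* For positive integers $n_1$ and $n$ with $1\le n_1<n$, $$|\Upsilon_{\{1,\dots,n\}}|=\sum_{\alpha\in\Upsilon_{\{1,\dots,n_1\}},\ \beta\in\Upsilon_{\{n_1+1,\dots,n\}}}\big|[\alpha\vee\beta,\ \alpha\times\beta]\big|.$$
   Context: For a finite set $N$ of positive integers, an antimonotonic function on $2^N$ is a boolean function on $2^N$, identified with the set $\alpha$ of subsets of $N$ on which it is true, such that no element of $\alpha$ is a proper subset of another element of $\alpha$. $AMT(N)$ is the set of all of them (both $\emptyset$ and $\{\emptyset\}$ belong to it). Order: $\alpha\le\beta$ iff every $A\in\alpha$ is contained in some $B\in\beta$. The interval $[\alpha,\beta]$ is the set of antimonotonic functions $\kappa$ (on subsets of $\{1,\dots,n\}$) with $\alpha\le\kappa\le\beta$. For a family $\mathcal{S}$ of sets, $\sup(\mathcal{S})$ is the set of inclusion-maximal members of $\mathcal{S}$. The span is $sp(\alpha)=\bigcup_{A\in\alpha}A$. Join: $\alpha\vee\beta=\sup(\alpha\cup\beta)$. External product: $\alpha\times\beta=\sup\{(A\setminus sp(\beta))\cup(B\setminus sp(\alpha))\cup(A\cap B)\mid A\in\alpha,\,B\in\beta\}$; for $\alpha,\beta\neq\emptyset$ this is the largest antimonotonic $\kappa$ with $sp(\kappa)=sp(\alpha)\cup sp(\beta)$, $\sup\{K\cap sp(\alpha)\mid K\in\kappa\}\le\alpha$ and $\sup\{K\cap sp(\beta)\mid K\in\kappa\}\le\beta$. For a nonempty finite set $M$ of positive integers, $\Upsilon_M=[\{\{x\}\mid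 x\in M\},\{M\}]$, which is the set of antimonotonic functions with span $M$. *)

theory Defs
  imports Main
begin

(* A boolean function on 2^N is represented by the family of subsets of N on which it is true. *)

definition AMT :: "nat set \<Rightarrow> nat set set set" where
  "AMT N = {\<alpha>. \<alpha> \<subseteq> Pow N \<and> (\<forall>A\<in>\<alpha>. \<forall>B\<in>\<alpha>. \<not> A \<subset> B)}"

definition amt_le :: "nat set set \<Rightarrow> nat set set \<Rightarrow> bool" where
  "amt_le \<alpha> \<beta> \<longleftrightarrow> (\<forall>A\<in>\<alpha>. \<exists>B\<in>\<beta>. A \<subseteq> B)"

(* The ambient ground set N is an explicit parameter; in the application it is {1..n}. *)
definition amt_interval :: "nat set \<Rightarrow> nat set set \<Rightarrow> nat set set \<Rightarrow> nat set set set" where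
  "amt_interval N \<alpha> \<beta> = {\<kappa> \<in> AMT N. amt_le \<alpha> \<kappa> \<and> amt_le \<kappa> \<beta>}"

definition max_sets :: "nat set set \<Rightarrow> nat set set" where
  "max_sets S = {A \<in> S. \<forall>B\<in>S. \<not> A \<subset> B}"

definition sp :: "nat set set \<Rightarrow> nat set" where
  "sp \<alpha> = (\<Union>A\<in>\<alpha>. A)"

definition amt_join :: "nat set set \<Rightarrow> nat set set \<Rightarrow> nat set set" where
  "amt_join \<alpha> \<beta> = max_sets (\<alpha> \<union> \<beta>)"

definition ext_prod :: "nat set set \<Rightarrow> nat set set \<Rightarrow> nat set set" where
  "ext_prod \<alpha> \<beta> = max_sets {(A - sp \<beta>) \<union> (B - sp \<alpha>) \<union> (A \<inter> B) | A B. A \<in> \<alpha> \<and> B \<in> \<beta>}"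

(* Meant for nonempty M included in N. *)
definition Upsilon :: "nat set \<Rightarrow> nat set \<Rightarrow> nat set set set" where
  "Upsilon N M = amt_interval N {{x} | x. x \<in> M} {M}"

end

theory Submission
  imports Defs
begin

text \<open>
  Let the finite ground set \<open>N\<close> be split into nonempty blocks \<open>M\<close> and \<open>P\<close>. Cutting all members of
  an antichain \<open>\<kappa>\<close> with span \<open>N\<close> down to a block and keeping the maximal traces gives an antichain
  whose span is that block (\<open>trace\<close> below), so \<open>\<kappa> \<mapsto> (trace \<kappa> M, trace \<kappa> P)\<close> sorts the antichains
  with span \<open>N\<close> into disjoint fibres indexed by pairs \<open>(\<alpha>, \<beta>)\<close>. Each fibre is exactly the
  interval from \<open>\<alpha> \<or> \<beta>\<close> to \<open>\<alpha> \<times> \<beta>\<close> (lemma \<open>interval_eq_trace_fibre\<close>), so the formula adds up the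
  sizes of the fibres.

  The fibres are intervals for the following reason. An antichain is determined by its down-set, so
  \<open>trace \<kappa> M = \<alpha>\<close> means that \<open>\<alpha>\<close> and the family of all \<open>K \<inter> M\<close> lie below each other
  (lemma \<open>max_sets_eq_iff\<close>). That \<open>\<alpha>\<close> and \<open>\<beta>\<close> lie below the traces says precisely that every
  member of \<open>\<alpha> \<union> \<beta>\<close> lies in some \<open>K\<close>. Since \<open>\<alpha>\<close> and \<open>\<beta>\<close> live on disjoint sets, their external
  product consists of the maximal unions \<open>A \<union> B\<close>, and \<open>K \<subseteq> A \<union> B\<close> splits into \<open>K \<inter> M \<subseteq> A\<close> and
  \<open>K \<inter> P \<subseteq> B\<close>, where \<open>A\<close> and \<open>B\<close> can be chosen independently.
\<close>

lemma amt_le_trans: "amt_le \<alpha> \<beta> \<Longrightarrow> amt_le \<beta> \<gamma> \<Longrightarrow> amt_le \<alpha> \<gamma>"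
  unfolding amt_le_def by (meson subset_trans)

lemma sp_mono: "amt_le \<alpha> \<beta> \<Longrightarrow> sp \<alpha> \<subseteq> sp \<beta>"
  unfolding amt_le_def sp_def by blast

lemma finite_AMT: "finite N \<Longrightarrow> finite (AMT N)"
  by (rule finite_subset[of _ "Pow (Pow N)"]) (auto simp: AMT_def)

lemma AMT_finite: "finite N \<Longrightarrow> \<kappa> \<in> AMT N \<Longrightarrow> finite \<kappa>"
  by (auto simp: AMT_def intro: finite_subset[of \<kappa> "Pow N"])

lemma amt_le_max_sets: "finite S \<Longrightarrow> amt_le S (max_sets S)"
  unfolding amt_le_def
proof
  fix A assume "finite S" "A \<in> S"
  then obtain B where "B \<in> S" "A \<subseteq> B" "\<forall>C\<in>S. B \<subseteq> C \<longrightarrow> B = C"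
    using finite_has_maximal2[of S A] by auto
  then show "\<exists>B\<in>max_sets S. A \<subseteq> B"
    unfolding max_sets_def by blast
qed

lemma max_sets_amt_le: "amt_le (max_sets S) S"
  unfolding amt_le_def max_sets_def by blast

lemma amt_le_max_sets_right: "finite S \<Longrightarrow> amt_le \<alpha> (max_sets S) \<longleftrightarrow> amt_le \<alpha> S"
  by (meson amt_le_trans[of \<alpha> "max_sets S" S] amt_le_trans[of \<alpha> S "max_sets S"]
      amt_le_max_sets max_sets_amt_le)

lemma amt_le_max_sets_left: "finite S \<Longrightarrow> amt_le (max_sets S) \<alpha> \<longleftrightarrow> amt_le S \<alpha>"
  by (meson amt_le_trans[of "max_sets S" S \<alpha>] amt_le_trans[of S "max_sets S" \<alpha>]
      amt_le_max_sets max_sets_amt_le)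

lemma sp_max_sets: "finite S \<Longrightarrow> sp (max_sets S) = sp S"
  by (simp add: amt_le_max_sets max_sets_amt_le sp_mono subset_antisym)

text \<open>On antichains the preorder is antisymmetric: if \<open>A \<subseteq> B \<subseteq> A'\<close> with \<open>A, A'\<close> in one antichain,
  then \<open>A = A'\<close> and hence \<open>A = B\<close>.\<close>

lemma amt_le_antisym:
  assumes "\<alpha> \<in> AMT N" "\<beta> \<in> AMT N'" "amt_le \<alpha> \<beta>" "amt_le \<beta> \<alpha>"
  shows "\<alpha> = \<beta>"
proof -
  have "\<gamma> \<subseteq> \<delta>" if \<gamma>: "\<gamma> \<in> AMT K" and le: "amt_le \<gamma> \<delta>" "amt_le \<delta> \<gamma>" for \<gamma> \<delta> K
  proof
    fix A assume "A \<in> \<gamma>"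
    then obtain B A' where "B \<in> \<delta>" "A \<subseteq> B" "A' \<in> \<gamma>" "B \<subseteq> A'"
      using le unfolding amt_le_def by meson
    moreover have "\<not> A \<subset> A'"
      using \<gamma> \<open>A \<in> \<gamma>\<close> \<open>A' \<in> \<gamma>\<close> by (auto simp: AMT_def)
    ultimately show "A \<in> \<delta>"
      by (metis psubsetI subset_antisym subset_trans)
  qed
  with assms show ?thesis by blast
qed

lemma max_sets_AMT: "S \<subseteq> Pow N \<Longrightarrow> max_sets S \<in> AMT N"
  unfolding AMT_def max_sets_def by blast

lemma max_sets_eq_iff:
  assumes "finite N" "S \<subseteq> Pow N" "\<alpha> \<in> AMT N"
  shows "max_sets S = \<alpha> \<longleftrightarrow> amt_le \<alpha> S \<and> amt_le S \<alpha>"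
proof -
  have "finite S"
    using assms(1,2) by (meson finite_Pow_iff finite_subset)
  then have le: "amt_le \<alpha> (max_sets S) \<longleftrightarrow> amt_le \<alpha> S" "amt_le (max_sets S) \<alpha> \<longleftrightarrow> amt_le S \<alpha>"
    by (simp_all add: amt_le_max_sets_right amt_le_max_sets_left)
  have "amt_le \<alpha> \<alpha>"
    unfolding amt_le_def by blast
  then show ?thesis
    using le amt_le_antisym[OF max_sets_AMT[OF assms(2)] assms(3)] by auto
qed

lemma Upsilon_iff_sp: "\<kappa> \<in> Upsilon N M \<longleftrightarrow> \<kappa> \<in> AMT N \<and> sp \<kappa> = M"
  unfolding Upsilon_def amt_interval_def amt_le_def sp_def by blast

definition trace :: "nat set set \<Rightarrow> nat set \<Rightarrow> nat set set" where
  "trace \<kappa> M = max_sets ((\<lambda>K. K \<inter> M) ` \<kappa>)"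

lemma trace_Upsilon:
  assumes "finite N" "\<kappa> \<in> Upsilon N N" "M \<subseteq> N"
  shows "trace \<kappa> M \<in> Upsilon N M"
proof -
  have \<kappa>: "\<kappa> \<in> AMT N" "sp \<kappa> = N"
    using assms by (auto simp: Upsilon_iff_sp)
  have "sp (trace \<kappa> M) = sp ((\<lambda>K. K \<inter> M) ` \<kappa>)"
    unfolding trace_def using AMT_finite[OF assms(1) \<kappa>(1)] by (simp add: sp_max_sets)
  also have "\<dots> = sp \<kappa> \<inter> M"
    unfolding sp_def by blast
  also have "\<dots> = M"
    using \<kappa>(2) assms(3) by blast
  finally show ?thesis
    unfolding Upsilon_iff_sp trace_def using assms(3)
    by (auto intro: max_sets_AMT)
qed

text \<open>For disjoint spans the external product is the full product; no part of \<open>A\<close> or \<open>B\<close> is cut.\<close>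

lemma ext_prod_disjoint:
  assumes "sp \<alpha> \<inter> sp \<beta> = {}"
  shows "ext_prod \<alpha> \<beta> = max_sets ((\<lambda>(A, B). A \<union> B) ` (\<alpha> \<times> \<beta>))"
proof -
  have "{(A - sp \<beta>) \<union> (B - sp \<alpha>) \<union> (A \<inter> B) | A B. A \<in> \<alpha> \<and> B \<in> \<beta>} =
      (\<lambda>(A, B). (A - sp \<beta>) \<union> (B - sp \<alpha>) \<union> (A \<inter> B)) ` (\<alpha> \<times> \<beta>)"
    by auto
  also have "\<dots> = (\<lambda>(A, B). A \<union> B) ` (\<alpha> \<times> \<beta>)"
  proof (rule image_cong[OF refl], clarify)
    fix A B assume "A \<in> \<alpha>" "B \<in> \<beta>"
    then show "(A - sp \<beta>) \<union> (B - sp \<alpha>) \<union> (A \<inter> B) = A \<union> B"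
      using assms unfolding sp_def by blast
  qed
  finally show ?thesis
    unfolding ext_prod_def by simp
qed

text \<open>This is where the two bounds of the interval get their meaning: the join bounds both traces
  from below, the external product bounds both from above.\<close>

lemma interval_eq_trace_fibre:
  assumes fin: "finite N" and N: "M \<union> P = N" "M \<inter> P = {}" and ne: "M \<noteq> {}" "P \<noteq> {}"
    and \<alpha>: "\<alpha> \<in> Upsilon N M" and \<beta>: "\<beta> \<in> Upsilon N P"
  shows "amt_interval N (amt_join \<alpha> \<beta>) (ext_prod \<alpha> \<beta>) =
    {\<kappa> \<in> Upsilon N N. (trace \<kappa> M, trace \<kappa> P) = (\<alpha>, \<beta>)}"
proof -
  have amt: "\<alpha> \<in> AMT N" "\<beta> \<in> AMT N" and sp: "sp \<alpha> = M" "sp \<beta> = P"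
    using \<alpha> \<beta> by (auto simp: Upsilon_iff_sp)
  have fin': "finite \<alpha>" "finite \<beta>"
    using amt AMT_finite fin by auto
  have subM: "A \<subseteq> M" if "A \<in> \<alpha>" for A using that sp by (auto simp: sp_def)
  have subP: "B \<subseteq> P" if "B \<in> \<beta>" for B using that sp by (auto simp: sp_def)
  \<comment> \<open>Without this the product would be empty, whatever the other factor is.\<close>
  have nonempty: "\<alpha> \<noteq> {}" "\<beta> \<noteq> {}"
    using sp ne by (auto simp: sp_def)
  have "\<kappa> \<in> amt_interval N (amt_join \<alpha> \<beta>) (ext_prod \<alpha> \<beta>) \<longleftrightarrow>
      \<kappa> \<in> Upsilon N N \<and> trace \<kappa> M = \<alpha> \<and> trace \<kappa> P = \<beta>" if \<kappa>: "\<kappa> \<in> AMT N" for \<kappa>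
  proof -
    have K: "K \<subseteq> M \<union> P" if "K \<in> \<kappa>" for K using \<kappa> that N by (auto simp: AMT_def)
    have lower: "amt_le (amt_join \<alpha> \<beta>) \<kappa> \<longleftrightarrow>
        amt_le \<alpha> ((\<lambda>K. K \<inter> M) ` \<kappa>) \<and> amt_le \<beta> ((\<lambda>K. K \<inter> P) ` \<kappa>)"
    proof -
      have "amt_le (amt_join \<alpha> \<beta>) \<kappa> \<longleftrightarrow> amt_le (\<alpha> \<union> \<beta>) \<kappa>"
        unfolding amt_join_def using fin' by (simp add: amt_le_max_sets_left)
      also have "\<dots> \<longleftrightarrow> amt_le \<alpha> \<kappa> \<and> amt_le \<beta> \<kappa>"
        unfolding amt_le_def by blast
      also have "\<dots> \<longleftrightarrow> amt_le \<alpha> ((\<lambda>K. K \<inter> M) ` \<kappa>) \<and> amt_le \<beta> ((\<lambda>K. K \<inter> P) ` \<kappa>)"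
        unfolding amt_le_def using subM subP by simp
      finally show ?thesis .
    qed
    have split: "K \<subseteq> A \<union> B \<longleftrightarrow> K \<inter> M \<subseteq> A \<and> K \<inter> P \<subseteq> B"
      if "K \<in> \<kappa>" "A \<in> \<alpha>" "B \<in> \<beta>" for K A B
      using K[OF that(1)] subM[OF that(2)] subP[OF that(3)] N(2) by blast
    have upper: "amt_le \<kappa> (ext_prod \<alpha> \<beta>) \<longleftrightarrow>
        amt_le ((\<lambda>K. K \<inter> M) ` \<kappa>) \<alpha> \<and> amt_le ((\<lambda>K. K \<inter> P) ` \<kappa>) \<beta>"
    proof -
      have "amt_le \<kappa> (ext_prod \<alpha> \<beta>) \<longleftrightarrow> (\<forall>K\<in>\<kappa>. \<exists>A\<in>\<alpha>. \<exists>B\<in>\<beta>. K \<subseteq> A \<union> B)"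
        using fin' sp N(2)
        by (simp add: ext_prod_disjoint amt_le_max_sets_right) (simp add: amt_le_def)
      also have "\<dots> \<longleftrightarrow> (\<forall>K\<in>\<kappa>. \<exists>A\<in>\<alpha>. \<exists>B\<in>\<beta>. K \<inter> M \<subseteq> A \<and> K \<inter> P \<subseteq> B)"
        using split by simp
      also have "\<dots> \<longleftrightarrow> amt_le ((\<lambda>K. K \<inter> M) ` \<kappa>) \<alpha> \<and> amt_le ((\<lambda>K. K \<inter> P) ` \<kappa>) \<beta>"
        unfolding amt_le_def by auto
      finally show ?thesis .
    qed
    have traces: "trace \<kappa> M = \<alpha> \<and> trace \<kappa> P = \<beta> \<longleftrightarrow>
        amt_le (amt_join \<alpha> \<beta>) \<kappa> \<and> amt_le \<kappa> (ext_prod \<alpha> \<beta>)"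
    proof -
      have "(\<lambda>K. K \<inter> M) ` \<kappa> \<subseteq> Pow N" "(\<lambda>K. K \<inter> P) ` \<kappa> \<subseteq> Pow N"
        using N by auto
      then show ?thesis
        unfolding trace_def lower upper
        by (simp add: max_sets_eq_iff[OF fin _ amt(1)] max_sets_eq_iff[OF fin _ amt(2)]) blast
    qed
    have "sp \<kappa> = N" if "amt_le (amt_join \<alpha> \<beta>) \<kappa>"
    proof
      show "sp \<kappa> \<subseteq> N" using \<kappa> by (auto simp: AMT_def sp_def)
      have "sp (amt_join \<alpha> \<beta>) = sp \<alpha> \<union> sp \<beta>"
        unfolding amt_join_def using fin' by (simp add: sp_max_sets) (auto simp: sp_def)
      then show "N \<subseteq> sp \<kappa>"
        using sp_mono[OF that] sp N(1) by simp
    qed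
    then show ?thesis
      using traces \<kappa> unfolding amt_interval_def Upsilon_iff_sp by blast
  qed
  then show ?thesis
    by (auto simp: amt_interval_def Upsilon_iff_sp)
qed

theorem card_Upsilon_eq_sum_intervals:
  assumes fin: "finite N" and N: "M \<union> P = N" "M \<inter> P = {}" "M \<noteq> {}" "P \<noteq> {}"
  shows "card (Upsilon N N) =
    (\<Sum>(\<alpha>, \<beta>) \<in> Upsilon N M \<times> Upsilon N P.
       card (amt_interval N (amt_join \<alpha> \<beta>) (ext_prod \<alpha> \<beta>)))"
proof -
  let ?f = "\<lambda>\<kappa>. (trace \<kappa> M, trace \<kappa> P)"
  have fU: "finite (Upsilon N L)" for L
    using finite_AMT[OF fin] by (rule finite_subset[rotated]) (auto simp: Upsilon_iff_sp)
  have sub: "?f ` Upsilon N N \<subseteq> Upsilon N M \<times> Upsilon N P"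
    using trace_Upsilon[OF fin] N by auto
  have "card (Upsilon N N) =
      (\<Sum>p \<in> Upsilon N M \<times> Upsilon N P. card {\<kappa> \<in> Upsilon N N. ?f \<kappa> = p})"
    using sum.group[OF fU finite_cartesian_product[OF fU fU] sub, of "\<lambda>_. 1::nat"] by simp
  also have "\<dots> = (\<Sum>(\<alpha>, \<beta>) \<in> Upsilon N M \<times> Upsilon N P.
       card (amt_interval N (amt_join \<alpha> \<beta>) (ext_prod \<alpha> \<beta>)))"
    using interval_eq_trace_fibre[OF fin N] by (intro sum.cong) auto
  finally show ?thesis .
qed

theorem corollary5:
  fixes n1 n :: nat
  assumes "1 \<le> n1" and "n1 < n"
  shows "card (Upsilon {1..n} {1..n}) =
    (\<Sum>(\<alpha>, \<beta>) \<in> Upsilon {1..n} {1..n1} \<times> Upsilon {1..n} {n1+1..n}.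
       card (amt_interval {1..n} (amt_join \<alpha> \<beta>) (ext_prod \<alpha> \<beta>)))"
  using assms by (intro card_Upsilon_eq_sum_intervals) auto

end
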